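(* For any continuous nonnegative function $f:[0,1]\to\mathbb{R}$ and any integers $m\geq 0$ and $n\geq m$, there exists a unique $p\in\mathcal{P}^{m,n}$ minimizing $\|f-p\|_{L^2}$ over $\mathcal{P}^{m,n}$.
   Context: $\mathcal{P}^m$ denotes the space of real univariate polynomials of degree at most $m$. The Bernstein polynomials of degree $n$ are $B^n_i(x)=\binom{n}{i}x^i(1-x)^{n-i}$, $0\leq i\leq n$; they form a basis of $\mathcal{P}^n$. For $p\in\mathcal{P}^m$, $\mathbf{\Pi}(p)\in\mathbb{R}^{m+1}$ denotes the vector of coefficients of $p$ in the basis $\{B^m_i\}_{i=0}^m$, i.e. $p=\sum_{i=0}^m \mathbf{\Pi}(p)_iB^m_i$. For $m\leq n$, $E^{m,n}$ is the $(n+1)\times(m+1)$ degree elevation matrix, which maps the degree $m$ Bernstein coefficients of a polynomial in $\mathcal{P}^m$ to its degree $n$ Bernstein coefficients; its entries are $E^{m,n}_{ij}=\binom{m}{j}\binom{n-m}{i-j}/\binom{n}{i}$, $0\le i\le n$, $0\le j\le m$ (binomial coefficients with lower index negative or exceeding the upper index are $0$). Define $\mathcal{P}^{m,n}=\{p\in\mathcal{P}^m : E^{m,n}\mathbf{\Pi}(p)\geq 0 \text{ componentwise}\}$. The norm is $\|g\|_{L^2}=\left(\int_0^1 g(x)^2\,dx\right)^{1/2}$. *)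

theory Defs
  imports
    "HOL-Analysis.Analysis"
    "HOL-Computational_Algebra.Polynomial"
    "Jordan_Normal_Form.Matrix"
begin

unbundle no vec_syntax

definition bernstein_coeffs :: "nat \<Rightarrow> real poly \<Rightarrow> real vec" where
  "bernstein_coeffs m p =
     (THE v. v \<in> carrier_vec (m + 1) \<and> (\<forall>x. poly p x = (\<Sum>i\<le>m. v $ i * Bernstein m i x)))"

lemma power_eq_sum_Bernstein:
  assumes "k \<le> m"
  shows "x ^ k =
    (\<Sum>i\<le>m. (if k \<le> i then real ((m - k) choose (i - k)) / real (m choose i) else 0) * Bernstein m i x)"
proof -
  have "x ^ k = x ^ k * (x + (1 - x)) ^ (m - k)"
    by simp
  also have "\<dots> = (\<Sum>j\<le>m - k. real ((m - k) choose j) * x ^ (k + j) * (1 - x) ^ (m - (k + j)))"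
    unfolding binomial_ring sum_distrib_left
    by (intro sum.cong) (auto simp: power_add)
  also have "\<dots> = (\<Sum>i\<in>{k..m}. real ((m - k) choose (i - k)) * x ^ i * (1 - x) ^ (m - i))"
    using assms
    by (intro sum.reindex_bij_witness[where i = "\<lambda>i. i - k" and j = "\<lambda>j. k + j"]) auto
  also have "\<dots> = (\<Sum>i\<in>{k..m}. (if k \<le> i then real ((m - k) choose (i - k)) / real (m choose i) else 0)
                      * Bernstein m i x)"
    by (intro sum.cong) (auto simp: Bernstein_def)
  also have "\<dots> = (\<Sum>i\<le>m. (if k \<le> i then real ((m - k) choose (i - k)) / real (m choose i) else 0)
                      * Bernstein m i x)"
    by (intro sum.mono_neutral_left) auto
  finally show ?thesis .
qed

lemma Bernstein_lin_indep:
  assumes "\<And>x. (\<Sum>i\<le>m. c i * Bernstein m i x) = 0" and "k \<le> m"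
  shows "c k = 0"
  using assms(2)
proof (induction k rule: less_induct)
  case (less k)
  define P where "P = (\<Sum>i\<le>m. Polynomial.smult (c i * real (m choose i)) (monom 1 i * [:1, -1:] ^ (m - i)))"
  have "poly P x = 0" for x
    using assms(1)[of x]
    by (simp add: P_def poly_sum poly_monom Bernstein_def mult.assoc)
  then have "P = 0"
    by (simp flip: poly_all_0_iff_0)
  have "0 = coeff P k"
    by (simp add: \<open>P = 0\<close>)
  also have "\<dots> = (\<Sum>i\<le>m. c i * real (m choose i) * (if k < i then 0 else coeff ([:1, -1:] ^ (m - i)) (k - i)))"
    by (auto simp: P_def coeff_sum coeff_monom_mult intro!: sum.cong)
  also have "\<dots> = (\<Sum>i\<le>m. if i = k then c k * real (m choose k) else 0)"
  proof (intro sum.cong refl)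
    fix i assume "i \<in> {..m}"
    have "coeff ([:1, -1:] ^ (m - k)) 0 = (1 :: real)"
      by (simp flip: poly_0_coeff_0)
    then show "c i * real (m choose i) * (if k < i then 0 else coeff ([:1, -1:] ^ (m - i)) (k - i)) =
        (if i = k then c k * real (m choose k) else 0)"
      using less.IH[of i] less.prems by (cases i k rule: linorder_cases) auto
  qed
  also have "\<dots> = c k * real (m choose k)"
    using less.prems by simp
  finally show "c k = 0"
    using less.prems by simp
qed

lemma bernstein_coeffs_ex1:
  assumes "degree p \<le> m"
  shows "\<exists>!v. v \<in> carrier_vec (m + 1) \<and> (\<forall>x. poly p x = (\<Sum>i\<le>m. v $ i * Bernstein m i x))"
proof (rule ex_ex1I)
  define a where "a i k = (if k \<le> i then real ((m - k) choose (i - k)) / real (m choose i) else 0)" for i k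
  define v where "v = vec (m + 1) (\<lambda>i. \<Sum>k\<le>m. coeff p k * a i k)"
  have "poly p x = (\<Sum>i\<le>m. v $ i * Bernstein m i x)" for x
  proof -
    have "poly p x = (\<Sum>k\<le>m. coeff p k * x ^ k)"
      unfolding poly_altdef using assms
      by (intro sum.mono_neutral_left) (auto simp: coeff_eq_0)
    also have "\<dots> = (\<Sum>k\<le>m. \<Sum>i\<le>m. coeff p k * a i k * Bernstein m i x)"
      by (intro sum.cong refl)
         (simp add: power_eq_sum_Bernstein[of _ m x] a_def sum_distrib_left mult.assoc)
    also have "\<dots> = (\<Sum>i\<le>m. \<Sum>k\<le>m. coeff p k * a i k * Bernstein m i x)"
      by (rule sum.swap)
    also have "\<dots> = (\<Sum>i\<le>m. v $ i * Bernstein m i x)"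
      by (intro sum.cong refl) (simp add: v_def sum_distrib_right)
    finally show ?thesis .
  qed
  then show "\<exists>v. v \<in> carrier_vec (m + 1) \<and> (\<forall>x. poly p x = (\<Sum>i\<le>m. v $ i * Bernstein m i x))"
    by (intro exI[of _ v]) (simp add: v_def)
next
  fix v w :: "real vec"
  assume v: "v \<in> carrier_vec (m + 1) \<and> (\<forall>x. poly p x = (\<Sum>i\<le>m. v $ i * Bernstein m i x))"
    and w: "w \<in> carrier_vec (m + 1) \<and> (\<forall>x. poly p x = (\<Sum>i\<le>m. w $ i * Bernstein m i x))"
  have "(\<Sum>i\<le>m. (v $ i - w $ i) * Bernstein m i x) = 0" for x
  proof -
    have "(\<Sum>i\<le>m. v $ i * Bernstein m i x) = (\<Sum>i\<le>m. w $ i * Bernstein m i x)"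
      using v w by metis
    then show ?thesis
      by (simp add: left_diff_distrib sum_subtractf)
  qed
  then have "v $ i - w $ i = 0" if "i \<le> m" for i
    using Bernstein_lin_indep[of "\<lambda>i. v $ i - w $ i" m i] that by blast
  then show "v = w"
    using v w by (intro eq_vecI) auto
qed

text \<open>The case distinction is needed because \<open>i - j\<close> is truncated on \<^typ>\<open>nat\<close>.\<close>

definition degree_elevation :: "nat \<Rightarrow> nat \<Rightarrow> real mat" where
  "degree_elevation m n = mat (n + 1) (m + 1) (\<lambda>(i, j).
     if j \<le> i then real (m choose j) * real ((n - m) choose (i - j)) / real (n choose i) else 0)"

text \<open>The order on \<^typ>\<open>real vec\<close> is componentwise.\<close>

definition nonneg_bernstein :: "nat \<Rightarrow> nat \<Rightarrow> real poly set" where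
  "nonneg_bernstein m n =
     {p. degree p \<le> m \<and> 0\<^sub>v (n + 1) \<le> degree_elevation m n *\<^sub>v bernstein_coeffs m p}"

definition L2_norm01 :: "(real \<Rightarrow> real) \<Rightarrow> real" where
  "L2_norm01 g = sqrt (integral {0..1} (\<lambda>x. (g x)\<^sup>2))"

end

theory Submission
  imports Defs
begin

text \<open>
  Polynomials of degree at most \<open>m\<close> are identified with their Bernstein coefficient vectors \<open>c\<close>,
  which are encoded as functions \<^typ>\<open>nat \<Rightarrow> real\<close> vanishing beyond \<open>m\<close>. The admissible vectors
  form a nonempty closed convex set \<open>K\<close>, being cut out by finitely many homogeneous linear
  inequalities, and the theorem becomes an instance of linear least squares with a convex constraint
  (\<open>convex_least_squares_ex1\<close>).

  Existence: the squared distance \<open>c \<mapsto> \<integral>(f - \<Sum>i\<le>m. c i * b i)\<^sup>2\<close> is a quadratic polynomial in \<open>c\<close>,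
  hence continuous. By linear independence of the \<open>b i\<close>, the quadratic form
  \<open>c \<mapsto> \<integral>(\<Sum>i\<le>m. c i * b i)\<^sup>2\<close> is positive on the compact unit sphere, and so bounded below there
  by some \<open>\<mu> > 0\<close>. Consequently the vectors in \<open>K\<close> that are at least as good as a given one form a
  compact set, on which the squared distance attains its minimum.

  Uniqueness: by the parallelogram law, the midpoint of two distinct minimizers would be strictly
  better than both.
\<close>

section \<open>Linear combinations and their squared distance to a function\<close>

text \<open>The combination of \<open>b 0, \<dots>, b m\<close> with coefficients \<open>c\<close>; entries of \<open>c\<close> beyond \<open>m\<close> are
  ignored.\<close>

definition lin_comb :: "(nat \<Rightarrow> real \<Rightarrow> real) \<Rightarrow> nat \<Rightarrow> (nat \<Rightarrow> real) \<Rightarrow> real \<Rightarrow> real" where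
  "lin_comb b m c x = (\<Sum>i\<le>m. c i * b i x)"

text \<open>The squared \<open>L\<^sup>2\<close> distance on the unit interval; it is \<open>0\<close> by default when the integral does
  not exist.\<close>

definition sq_dist01 :: "(real \<Rightarrow> real) \<Rightarrow> (real \<Rightarrow> real) \<Rightarrow> real" where
  "sq_dist01 f g = integral {0..1} (\<lambda>x. (f x - g x)\<^sup>2)"

lemma continuous_on_lin_comb:
  assumes "\<And>i. i \<le> m \<Longrightarrow> continuous_on S (b i)"
  shows "continuous_on S (lin_comb b m c)"
  unfolding lin_comb_def using assms by (intro continuous_intros) auto

lemma lin_comb_scale: "lin_comb b m (\<lambda>i. t * c i) x = t * lin_comb b m c x"
  by (simp add: lin_comb_def sum_distrib_left mult.assoc)

lemma lin_comb_diff: "lin_comb b m (\<lambda>i. c i - d i) x = lin_comb b m c x - lin_comb b m d x"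
  by (simp add: lin_comb_def left_diff_distrib sum_subtractf)

lemma lin_comb_midpoint:
  "lin_comb b m (\<lambda>i. (c i + d i) / 2) x = (lin_comb b m c x + lin_comb b m d x) / 2"
  by (simp add: lin_comb_def add_divide_distrib sum.distrib sum_divide_distrib distrib_right)

lemma sq_dist01_nonneg: "sq_dist01 f g \<ge> 0"
proof (cases "(\<lambda>x. (f x - g x)\<^sup>2) integrable_on {0..1}")
  case True
  then show ?thesis unfolding sq_dist01_def by (rule integral_nonneg) simp
next
  case False
  then show ?thesis by (simp add: sq_dist01_def not_integrable_integral)
qed

lemma sq_dist01_eq_0D:
  assumes "continuous_on {0..1} f" "continuous_on {0..1} g" "sq_dist01 f g = 0" "x \<in> {0..1}"
  shows "f x = g x"
proof -
  have cont: "continuous_on {0..1} (\<lambda>x. (f x - g x)\<^sup>2)"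
    using assms by (intro continuous_intros)
  then have "((\<lambda>x. (f x - g x)\<^sup>2) has_integral 0) (cbox 0 1)"
    using integrable_continuous_real[OF cont] assms(3)
    by (simp add: sq_dist01_def has_integral_integral)
  then have "(f x - g x)\<^sup>2 = 0"
    using cont assms(4) by (intro has_integral_0_cbox_imp_0) auto
  then show ?thesis by simp
qed

lemma parallelogram_sq_dist01:
  assumes "continuous_on {0..1} f" "continuous_on {0..1} g" "continuous_on {0..1} h"
  shows "sq_dist01 f (\<lambda>x. (g x + h x) / 2) =
         sq_dist01 f g / 2 + sq_dist01 f h / 2 - sq_dist01 g h / 4"
proof -
  have "((\<lambda>x. (u x - v x)\<^sup>2) has_integral sq_dist01 u v) {0..1}"
    if "continuous_on {0..1} u" "continuous_on {0..1} v" for u v :: "real \<Rightarrow> real"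
    unfolding sq_dist01_def using that
    by (intro integrable_integral integrable_continuous_real continuous_intros)
  then have "((\<lambda>x. (f x - g x)\<^sup>2 / 2 + (f x - h x)\<^sup>2 / 2 - (g x - h x)\<^sup>2 / 4) has_integral
      sq_dist01 f g / 2 + sq_dist01 f h / 2 - sq_dist01 g h / 4) {0..1}"
    using assms by (intro has_integral_add has_integral_diff has_integral_divide)
  moreover have "(f x - (g x + h x) / 2)\<^sup>2 =
      (f x - g x)\<^sup>2 / 2 + (f x - h x)\<^sup>2 / 2 - (g x - h x)\<^sup>2 / 4" for x
    by (simp add: power2_eq_square field_simps)
  ultimately show ?thesis
    unfolding sq_dist01_def[of f "\<lambda>x. (g x + h x) / 2"] by (simp only: integral_unique)
qed

lemma sq_dist01_continuous_in_coeffs: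
  assumes f: "continuous_on {0..1} f"
    and b: "\<And>i. i \<le> m \<Longrightarrow> continuous_on {0..1} (b i)"
  shows "continuous_on UNIV (\<lambda>c. sq_dist01 f (lin_comb b m c))"
proof -
  have int_fb: "(\<lambda>x. f x * b i x) integrable_on {0..1}" if "i \<le> m" for i
    using that f b by (intro integrable_continuous_real continuous_intros) auto
  have int_bb: "(\<lambda>x. b i x * b j x) integrable_on {0..1}" if "i \<le> m" "j \<le> m" for i j
    using that b by (intro integrable_continuous_real continuous_intros) auto
  have int_ff: "(\<lambda>x. (f x)\<^sup>2) integrable_on {0..1}"
    using f by (intro integrable_continuous_real continuous_intros) auto
  have "sq_dist01 f (lin_comb b m c) =
      integral {0..1} (\<lambda>x. (f x)\<^sup>2) - 2 * (\<Sum>i\<le>m. c i * integral {0..1} (\<lambda>x. f x * b i x))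
      + (\<Sum>i\<le>m. \<Sum>j\<le>m. c i * c j * integral {0..1} (\<lambda>x. b i x * b j x))" for c
  proof -
    have "(f x - lin_comb b m c x)\<^sup>2 = (f x)\<^sup>2 - 2 * (\<Sum>i\<le>m. c i * (f x * b i x))
        + (\<Sum>i\<le>m. \<Sum>j\<le>m. c i * c j * (b i x * b j x))" for x
    proof -
      have "f x * lin_comb b m c x = (\<Sum>i\<le>m. c i * (f x * b i x))"
        by (simp add: lin_comb_def sum_distrib_left algebra_simps)
      moreover have "(lin_comb b m c x)\<^sup>2 = (\<Sum>i\<le>m. \<Sum>j\<le>m. c i * c j * (b i x * b j x))"
        by (simp add: lin_comb_def power2_eq_square sum_product algebra_simps)
      ultimately show ?thesis by (simp add: power2_diff)
    qed
    moreover have "((\<lambda>x. (f x)\<^sup>2 - 2 * (\<Sum>i\<le>m. c i * (f x * b i x))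
        + (\<Sum>i\<le>m. \<Sum>j\<le>m. c i * c j * (b i x * b j x))) has_integral
      integral {0..1} (\<lambda>x. (f x)\<^sup>2) - 2 * (\<Sum>i\<le>m. c i * integral {0..1} (\<lambda>x. f x * b i x))
      + (\<Sum>i\<le>m. \<Sum>j\<le>m. c i * c j * integral {0..1} (\<lambda>x. b i x * b j x))) {0..1}"
      by (intro has_integral_add has_integral_diff has_integral_mult_right has_integral_sum
          integrable_integral int_ff int_fb int_bb) auto
    ultimately show ?thesis
      by (simp add: sq_dist01_def integral_unique)
  qed
  then show ?thesis
    by (auto intro!: continuous_intros)
qed

section \<open>Least squares over a closed convex set of coefficients\<close>

text \<open>The topology on \<^typ>\<open>nat \<Rightarrow> real\<close> is the product topology, so compactness of a box is
  Tychonoff's theorem.\<close>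

lemma compact_coeff_box: "compact {c :: nat \<Rightarrow> real. (\<forall>i\<le>m. \<bar>c i\<bar> \<le> R) \<and> (\<forall>i>m. c i = 0)}"
proof -
  have "compactin (product_topology (\<lambda>_. euclidean) UNIV)
          (PiE UNIV (\<lambda>i::nat. if i \<le> m then {-R..R} else {0}))"
    by (subst compactin_PiE) auto
  moreover have "PiE UNIV (\<lambda>i::nat. if i \<le> m then {-R..R} else {0}) =
      {c. (\<forall>i\<le>m. \<bar>c i\<bar> \<le> R) \<and> (\<forall>i>m. c i = 0)}"
    by (force simp: PiE_UNIV_domain Pi_iff abs_le_iff split: if_splits)
  ultimately show ?thesis
    by (simp add: euclidean_product_topology)
qed

text \<open>Coercivity of the Gram form of a linearly independent family: the form is homogeneous of
  degree two, so its minimum on the unit sphere serves as \<open>\<mu>\<close>. This replaces the equivalence of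
  norms on a finite-dimensional space.\<close>

lemma gram_form_coercive:
  assumes b: "\<And>i. i \<le> m \<Longrightarrow> continuous_on {0..1} (b i)"
    and indep: "\<And>c i. \<lbrakk>\<And>x. x \<in> {0..1} \<Longrightarrow> lin_comb b m c x = 0; i \<le> m\<rbrakk> \<Longrightarrow> c i = 0"
  obtains \<mu> where "\<mu> > 0"
    and "\<And>c. \<mu> * (\<Sum>i\<le>m. (c i)\<^sup>2) \<le> sq_dist01 (\<lambda>_. 0) (lin_comb b m c)"
proof -
  define Q where "Q c = sq_dist01 (\<lambda>_. 0) (lin_comb b m c)" for c
  define S where "S = {c :: nat \<Rightarrow> real. (\<forall>i\<le>m. \<bar>c i\<bar> \<le> 1) \<and> (\<forall>i>m. c i = 0)} \<inter> {c. (\<Sum>i\<le>m. (c i)\<^sup>2) = 1}"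
  have "compact S"
    unfolding S_def
    by (intro compact_Int_closed compact_coeff_box closed_Collect_eq continuous_intros) auto
  moreover have "(\<lambda>i. if i = 0 then 1 else 0) \<in> S"
    by (auto simp: S_def if_distrib[of "\<lambda>x. x\<^sup>2"] cong: if_cong)
  moreover have "continuous_on UNIV Q"
    unfolding Q_def by (intro sq_dist01_continuous_in_coeffs continuous_on_const b)
  then have "continuous_on S Q" by (rule continuous_on_subset) auto
  ultimately obtain e where e: "e \<in> S" "\<And>c. c \<in> S \<Longrightarrow> Q e \<le> Q c"
    using continuous_attains_inf[of S Q] by blast
  have "Q e > 0"
  proof (rule ccontr)
    assume "\<not> Q e > 0"
    then have "Q e = 0"
      using sq_dist01_nonneg[of "\<lambda>_. 0" "lin_comb b m e"] by (simp add: Q_def)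
    then have "lin_comb b m e x = 0" if "x \<in> {0..1}" for x
      using sq_dist01_eq_0D[OF continuous_on_const continuous_on_lin_comb[OF b] _ that] that
      by (auto simp: Q_def)
    then have "\<forall>i\<le>m. e i = 0" using indep by blast
    then show False using e(1) by (simp add: S_def)
  qed
  moreover have "Q e * (\<Sum>i\<le>m. (c i)\<^sup>2) \<le> Q c" for c
  proof (cases "(\<Sum>i\<le>m. (c i)\<^sup>2) = 0")
    case True
    then show ?thesis using sq_dist01_nonneg by (simp add: Q_def)
  next
    case False
    define r where "r = sqrt (\<Sum>i\<le>m. (c i)\<^sup>2)"
    have r2: "r\<^sup>2 = (\<Sum>i\<le>m. (c i)\<^sup>2)" by (simp add: r_def sum_nonneg)
    have r: "r > 0"
      using False by (simp add: r_def less_le sum_nonneg)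
    define d where "d i = (if i \<le> m then c i / r else 0)" for i
    have norm_d: "(\<Sum>i\<le>m. (d i)\<^sup>2) = 1"
    proof -
      have "(\<Sum>i\<le>m. (d i)\<^sup>2) = (\<Sum>i\<le>m. (c i)\<^sup>2) / r\<^sup>2"
        by (simp add: d_def power_divide sum_divide_distrib)
      then show ?thesis using r by (simp add: r2[symmetric])
    qed
    have "\<bar>d i\<bar> \<le> 1" if "i \<le> m" for i
    proof -
      have "(d i)\<^sup>2 \<le> (\<Sum>i\<le>m. (d i)\<^sup>2)"
        using that by (intro member_le_sum) auto
      then show ?thesis by (simp add: norm_d abs_square_le_1)
    qed
    then have "d \<in> S" by (auto simp: S_def norm_d) (simp add: d_def)
    then have "Q e \<le> Q d" by (rule e(2))
    moreover have "Q c = r\<^sup>2 * Q d"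
    proof -
      have "lin_comb b m c x = lin_comb b m (\<lambda>i. r * d i) x" for x
        using r by (simp add: lin_comb_def d_def)
      then have "lin_comb b m c x = r * lin_comb b m d x" for x
        by (simp add: lin_comb_scale)
      then show ?thesis by (simp add: Q_def sq_dist01_def power_mult_distrib)
    qed
    ultimately show ?thesis using r by (simp add: r2[symmetric] mult.commute)
  qed
  ultimately show ?thesis using that by (auto simp: Q_def)
qed

text \<open>Since \<open>K\<close> is closed, closure under midpoints amounts to convexity.\<close>

theorem convex_least_squares_ex1:
  assumes f: "continuous_on {0..1} f"
    and b: "\<And>i. i \<le> m \<Longrightarrow> continuous_on {0..1} (b i)"
    and indep: "\<And>c i. \<lbrakk>\<And>x. x \<in> {0..1} \<Longrightarrow> lin_comb b m c x = 0; i \<le> m\<rbrakk> \<Longrightarrow> c i = 0"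
    and closed: "closed K" and nonempty: "K \<noteq> {}"
    and supp: "\<And>c i. \<lbrakk>c \<in> K; m < i\<rbrakk> \<Longrightarrow> c i = 0"
    and midpoint: "\<And>c d. \<lbrakk>c \<in> K; d \<in> K\<rbrakk> \<Longrightarrow> (\<lambda>i. (c i + d i) / 2) \<in> K"
  shows "\<exists>!c. c \<in> K \<and> (\<forall>d\<in>K. sq_dist01 f (lin_comb b m c) \<le> sq_dist01 f (lin_comb b m d))"
proof (rule ex_ex1I)
  define F where "F c = sq_dist01 f (lin_comb b m c)" for c
  have contF: "continuous_on UNIV F"
    unfolding F_def by (rule sq_dist01_continuous_in_coeffs[OF f b])
  obtain c0 where c0: "c0 \<in> K" using nonempty by blast
  obtain \<mu> where \<mu>: "\<mu> > 0" "\<And>c. \<mu> * (\<Sum>i\<le>m. (c i)\<^sup>2) \<le> sq_dist01 (\<lambda>_. 0) (lin_comb b m c)"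
    by (rule gram_form_coercive[of m b]) (use b indep in blast)+
  define A where "A = sq_dist01 f (\<lambda>_. 0)"
  define R where "R = sqrt ((2 * A + 2 * F c0) / \<mu>)"
  \<comment> \<open>The parallelogram law for \<open>f\<close>, \<open>0\<close> and the combination bounds the Gram form at \<open>c\<close> by
      \<open>2 * A + 2 * F c\<close>, and coercivity turns this into a bound on the coefficients.\<close>
  have bound: "\<bar>c i\<bar> \<le> R" if "F c \<le> F c0" "i \<le> m" for c i
  proof -
    have "0 \<le> sq_dist01 f (\<lambda>x. (0 + lin_comb b m c x) / 2)"
      by (rule sq_dist01_nonneg)
    also have "\<dots> = A / 2 + F c / 2 - sq_dist01 (\<lambda>_. 0) (lin_comb b m c) / 4"
      unfolding A_def F_def
      by (rule parallelogram_sq_dist01[OF f continuous_on_const continuous_on_lin_comb[OF b]])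
    finally have "\<mu> * (\<Sum>i\<le>m. (c i)\<^sup>2) \<le> 2 * A + 2 * F c0"
      using \<mu>(2)[of c] that(1) by linarith
    moreover have "\<mu> * (c i)\<^sup>2 \<le> \<mu> * (\<Sum>i\<le>m. (c i)\<^sup>2)"
      using that(2) \<mu>(1) by (intro mult_left_mono member_le_sum) auto
    ultimately have "(c i)\<^sup>2 \<le> (2 * A + 2 * F c0) / \<mu>"
      unfolding pos_le_divide_eq[OF \<mu>(1)] by (simp only: mult.commute)
    then show ?thesis unfolding R_def by (metis real_sqrt_abs real_sqrt_le_iff)
  qed
  define L where
    "L = {c. (\<forall>i\<le>m. \<bar>c i\<bar> \<le> R) \<and> (\<forall>i>m. c i = 0)} \<inter> (K \<inter> {c. F c \<le> F c0})"
  have L_eq: "L = K \<inter> {c. F c \<le> F c0}"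
    using bound supp by (auto simp: L_def)
  have "compact L"
    unfolding L_def
    by (intro compact_Int_closed compact_coeff_box closed_Int closed closed_Collect_le contF
        continuous_on_const)
  moreover have "c0 \<in> L" using c0 by (simp add: L_eq)
  moreover have "continuous_on L F" using contF by (rule continuous_on_subset) auto
  ultimately obtain c where c: "c \<in> L" "\<And>d. d \<in> L \<Longrightarrow> F c \<le> F d"
    using continuous_attains_inf[of L F] by blast
  have "F c \<le> F d" if "d \<in> K" for d
  proof (cases "F d \<le> F c0")
    case True
    then show ?thesis using that c(2) by (simp add: L_eq)
  next
    case False
    then show ?thesis using c(1) by (simp add: L_eq)
  qed
  then show "\<exists>c. c \<in> K \<and> (\<forall>d\<in>K. sq_dist01 f (lin_comb b m c) \<le> sq_dist01 f (lin_comb b m d))"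
    using c(1) by (auto simp: L_eq F_def)
next
  fix c d
  assume c: "c \<in> K \<and> (\<forall>e\<in>K. sq_dist01 f (lin_comb b m c) \<le> sq_dist01 f (lin_comb b m e))"
    and d: "d \<in> K \<and> (\<forall>e\<in>K. sq_dist01 f (lin_comb b m d) \<le> sq_dist01 f (lin_comb b m e))"
  note cont = continuous_on_lin_comb[of m "{0..1}" b, OF b]
  have "sq_dist01 f (lin_comb b m c) \<le> sq_dist01 f (lin_comb b m (\<lambda>i. (c i + d i) / 2))"
    using c d midpoint by blast
  also have "lin_comb b m (\<lambda>i. (c i + d i) / 2) = (\<lambda>x. (lin_comb b m c x + lin_comb b m d x) / 2)"
    by (simp add: fun_eq_iff lin_comb_midpoint)
  finally have "sq_dist01 (lin_comb b m c) (lin_comb b m d) \<le> 0"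
    using c d parallelogram_sq_dist01[OF f cont cont, of c d] by fastforce
  then have "sq_dist01 (lin_comb b m c) (lin_comb b m d) = 0"
    using sq_dist01_nonneg[of "lin_comb b m c" "lin_comb b m d"] by linarith
  then have "lin_comb b m (\<lambda>i. c i - d i) x = 0" if "x \<in> {0..1}" for x
    using sq_dist01_eq_0D[OF cont cont _ that, of c d] by (simp add: lin_comb_diff)
  then have "c i = d i" if "i \<le> m" for i
    using indep[of "\<lambda>i. c i - d i" i] that by simp
  moreover have "c i = d i" if "m < i" for i
    using supp c d that by metis
  ultimately show "c = d" by (metis ext not_le)
qed

section \<open>Polynomials and their Bernstein coefficients\<close>

text \<open>The polynomial with Bernstein coefficients \<open>c 0, \<dots>, c m\<close> of degree \<open>m\<close>, inverting
  \<^const>\<open>bernstein_coeffs\<close>.\<close>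

definition bernstein_poly :: "nat \<Rightarrow> (nat \<Rightarrow> real) \<Rightarrow> real poly" where
  "bernstein_poly m c =
     (\<Sum>i\<le>m. Polynomial.smult (c i * real (m choose i)) (monom 1 i * [:1, -1:] ^ (m - i)))"

lemma poly_bernstein_poly: "poly (bernstein_poly m c) x = lin_comb (Bernstein m) m c x"
  by (simp add: bernstein_poly_def lin_comb_def poly_sum poly_monom Bernstein_def mult.assoc)

lemma degree_bernstein_poly: "degree (bernstein_poly m c) \<le> m"
  unfolding bernstein_poly_def
proof (rule degree_sum_le)
  fix i assume "i \<in> {..m}"
  then have "degree (monom 1 i * [:1, -1:] ^ (m - i) :: real poly) \<le> m"
    using degree_mult_le[of "monom 1 i :: real poly" "[:1, -1:] ^ (m - i)"]
      degree_power_le[of "[:1, -1 :: real:]" "m - i"] by (simp add: degree_monom_eq)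
  then show "degree (Polynomial.smult (c i * real (m choose i)) (monom 1 i * [:1, -1:] ^ (m - i))) \<le> m"
    using degree_smult_le order_trans by blast
qed simp

lemma bernstein_coeffs_bernstein_poly:
  "bernstein_coeffs m (bernstein_poly m c) = vec (m + 1) c"
  unfolding bernstein_coeffs_def
  by (rule the1_equality[OF bernstein_coeffs_ex1[OF degree_bernstein_poly]])
    (simp add: poly_bernstein_poly lin_comb_def)

lemma bernstein_poly_of_coeffs:
  assumes "degree p \<le> m"
  shows "bernstein_poly m (\<lambda>i. bernstein_coeffs m p $ i) = p"
proof -
  have "poly p x = (\<Sum>i\<le>m. bernstein_coeffs m p $ i * Bernstein m i x)" for x
    unfolding bernstein_coeffs_def using theI'[OF bernstein_coeffs_ex1[OF assms]] by blast
  then have "poly (bernstein_poly m (\<lambda>i. bernstein_coeffs m p $ i)) = poly p"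
    by (intro ext) (simp add: poly_bernstein_poly lin_comb_def)
  then show ?thesis by (simp only: poly_eq_poly_eq_iff)
qed

lemma poly_eq_0_on_unit_interval:
  fixes p :: "real poly"
  assumes "\<And>x. x \<in> {0..1} \<Longrightarrow> poly p x = 0"
  shows "p = 0"
proof (rule ccontr)
  assume "p \<noteq> 0"
  then have "finite {x. poly p x = 0}" by (rule poly_roots_finite)
  moreover have "{0..1} \<subseteq> {x. poly p x = 0}" using assms by auto
  ultimately have "finite {0..1 :: real}" by (rule rev_finite_subset)
  then show False using infinite_Icc[of "0::real" 1] by simp
qed

lemma Bernstein_lin_indep_on_unit_interval:
  assumes "\<And>x. x \<in> {0..1} \<Longrightarrow> lin_comb (Bernstein m) m c x = 0" and "i \<le> m"
  shows "c i = 0"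
proof -
  have "bernstein_poly m c = 0"
    using assms(1) by (intro poly_eq_0_on_unit_interval) (simp add: poly_bernstein_poly)
  then have "(\<Sum>i\<le>m. c i * Bernstein m i x) = 0" for x
    using poly_bernstein_poly[of m c x] by (simp add: lin_comb_def)
  then show ?thesis using Bernstein_lin_indep assms(2) by blast
qed

text \<open>Coefficient vectors whose elevation to degree \<open>n\<close> is nonnegative. Requiring the entries
  beyond \<open>m\<close> to vanish makes the vector unique for each polynomial.\<close>

definition elevation_cone :: "nat \<Rightarrow> nat \<Rightarrow> (nat \<Rightarrow> real) set" where
  "elevation_cone m n =
     {c. (\<forall>i>m. c i = 0) \<and> (\<forall>i\<le>n. 0 \<le> (\<Sum>j\<le>m. degree_elevation m n $$ (i, j) * c j))}"

lemma closed_elevation_cone: "closed (elevation_cone m n)"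
proof -
  have "elevation_cone m n = (\<Inter>i\<in>{m<..}. {c. c i = 0}) \<inter>
      (\<Inter>i\<in>{..n}. {c. 0 \<le> (\<Sum>j\<le>m. degree_elevation m n $$ (i, j) * c j)})"
    by (auto simp: elevation_cone_def)
  moreover have "closed ((\<Inter>i\<in>{m<..}. {c :: nat \<Rightarrow> real. c i = 0}) \<inter>
      (\<Inter>i\<in>{..n}. {c. 0 \<le> (\<Sum>j\<le>m. degree_elevation m n $$ (i, j) * c j)}))"
    by (intro closed_Int closed_INT ballI closed_Collect_eq closed_Collect_le continuous_intros) auto
  ultimately show ?thesis by simp
qed

lemma elevation_cone_midpoint:
  assumes "c \<in> elevation_cone m n" "d \<in> elevation_cone m n"
  shows "(\<lambda>i. (c i + d i) / 2) \<in> elevation_cone m n"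
proof -
  have "(\<Sum>j\<le>m. e j * ((c j + d j) / 2)) = ((\<Sum>j\<le>m. e j * c j) + (\<Sum>j\<le>m. e j * d j)) / 2" for e
    by (simp add: distrib_left add_divide_distrib sum.distrib sum_divide_distrib)
  then show ?thesis
    using assms unfolding elevation_cone_def mem_Collect_eq by (simp only:) simp
qed

lemma nonneg_bernstein_iff:
  assumes "\<And>i. m < i \<Longrightarrow> c i = 0"
  shows "bernstein_poly m c \<in> nonneg_bernstein m n \<longleftrightarrow> c \<in> elevation_cone m n"
proof -
  have "(degree_elevation m n *\<^sub>v vec (m + 1) c) $ i =
        (\<Sum>j\<le>m. degree_elevation m n $$ (i, j) * c j)" if "i \<le> n" for i
    using that
    by (simp add: degree_elevation_def scalar_prod_def lessThan_Suc_atMost flip: lessThan_atLeast0)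
  then show ?thesis
    using assms degree_bernstein_poly
    by (auto simp: nonneg_bernstein_def elevation_cone_def bernstein_coeffs_bernstein_poly
        less_eq_vec_def less_Suc_eq_le degree_elevation_def)
qed

lemma bij_betw_bernstein_poly:
  "bij_betw (bernstein_poly m) (elevation_cone m n) (nonneg_bernstein m n)"
proof (rule bij_betw_imageI)
  show "inj_on (bernstein_poly m) (elevation_cone m n)"
  proof (rule inj_onI)
    fix c d
    assume cd: "c \<in> elevation_cone m n" "d \<in> elevation_cone m n"
      and "bernstein_poly m c = bernstein_poly m d"
    then have eq: "vec (m + 1) c = vec (m + 1) d"
      by (metis bernstein_coeffs_bernstein_poly)
    show "c = d"
    proof
      fix i
      show "c i = d i"
      proof (cases "i \<le> m")
        case True
        then show ?thesis using arg_cong[OF eq, of "\<lambda>v. v $ i"] by simp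
      next
        case False
        then show ?thesis using cd by (simp add: elevation_cone_def)
      qed
    qed
  qed
  show "bernstein_poly m ` elevation_cone m n = nonneg_bernstein m n"
  proof (intro equalityI subsetI)
    fix p assume "p \<in> bernstein_poly m ` elevation_cone m n"
    then obtain c where c: "c \<in> elevation_cone m n" "p = bernstein_poly m c" by blast
    then have "\<And>i. m < i \<Longrightarrow> c i = 0" by (simp add: elevation_cone_def)
    then show "p \<in> nonneg_bernstein m n" using c nonneg_bernstein_iff by blast
  next
    fix p assume p: "p \<in> nonneg_bernstein m n"
    define c where "c i = (if i \<le> m then bernstein_coeffs m p $ i else 0)" for i
    have "bernstein_poly m c = bernstein_poly m (\<lambda>i. bernstein_coeffs m p $ i)"
      by (simp add: bernstein_poly_def c_def)
    then have "bernstein_poly m c = p"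
      using p bernstein_poly_of_coeffs by (simp add: nonneg_bernstein_def)
    moreover from this have "c \<in> elevation_cone m n"
      using p nonneg_bernstein_iff[of m c n] by (simp add: c_def)
    ultimately show "p \<in> bernstein_poly m ` elevation_cone m n" by blast
  qed
qed

section \<open>The best approximation\<close>

theorem theorem2:
  fixes f :: "real \<Rightarrow> real" and m n :: nat
  assumes "continuous_on {0..1} f"
    and "\<And>x. x \<in> {0..1} \<Longrightarrow> f x \<ge> 0"
    and "m \<le> n"
  shows "\<exists>!p. p \<in> nonneg_bernstein m n \<and>
           (\<forall>q \<in> nonneg_bernstein m n.
              L2_norm01 (\<lambda>x. f x - poly p x) \<le> L2_norm01 (\<lambda>x. f x - poly q x))"
proof -
  define K where "K = elevation_cone m n"
  define D where "D c = sq_dist01 f (lin_comb (Bernstein m) m c)" for c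
  have "\<exists>!c. c \<in> K \<and> (\<forall>d\<in>K. D c \<le> D d)"
    unfolding D_def
  proof (rule convex_least_squares_ex1)
    show "continuous_on {0..1} (Bernstein m i)" for i
      unfolding Bernstein_def by (intro continuous_intros)
    show "c i = 0"
      if "\<And>x. x \<in> {0..1} \<Longrightarrow> lin_comb (Bernstein m) m c x = 0" "i \<le> m" for c i
      using that by (rule Bernstein_lin_indep_on_unit_interval)
    have "(\<lambda>_. 0) \<in> K" by (simp add: K_def elevation_cone_def)
    then show "K \<noteq> {}" by blast
    show "closed K" unfolding K_def by (rule closed_elevation_cone)
    show "c i = 0" if "c \<in> K" "m < i" for c i
      using that by (simp add: K_def elevation_cone_def)
    show "(\<lambda>i. (c i + d i) / 2) \<in> K" if "c \<in> K" "d \<in> K" for c d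
      using that unfolding K_def by (rule elevation_cone_midpoint)
  qed (rule assms(1))
  then obtain c where c: "c \<in> K" "\<And>d. d \<in> K \<Longrightarrow> D c \<le> D d"
    and uniq: "\<And>c'. \<lbrakk>c' \<in> K; \<forall>d\<in>K. D c' \<le> D d\<rbrakk> \<Longrightarrow> c' = c"
    by auto
  have norm: "L2_norm01 (\<lambda>x. f x - poly (bernstein_poly m d) x) = sqrt (D d)" for d
    by (simp add: L2_norm01_def D_def sq_dist01_def poly_bernstein_poly)
  have image: "nonneg_bernstein m n = bernstein_poly m ` K"
    using bij_betw_bernstein_poly by (simp add: bij_betw_def K_def)
  show ?thesis
  proof (rule ex1I[of _ "bernstein_poly m c"])
    show "bernstein_poly m c \<in> nonneg_bernstein m n \<and>
        (\<forall>q \<in> nonneg_bernstein m n.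
           L2_norm01 (\<lambda>x. f x - poly (bernstein_poly m c) x) \<le> L2_norm01 (\<lambda>x. f x - poly q x))"
      using c by (auto simp: image norm)
  next
    fix p
    assume p: "p \<in> nonneg_bernstein m n \<and>
        (\<forall>q \<in> nonneg_bernstein m n.
           L2_norm01 (\<lambda>x. f x - poly p x) \<le> L2_norm01 (\<lambda>x. f x - poly q x))"
    then obtain c' where c': "c' \<in> K" "p = bernstein_poly m c'" by (auto simp: image)
    have "\<forall>d\<in>K. D c' \<le> D d"
      using p c' by (auto simp: image norm)
    then show "p = bernstein_poly m c" using uniq c' by simp
  qed
qed

end
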